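(* Let $T$ be a fixed tree with $e(T)$ edges, let $X_T$ be the number of labeled copies of $T$ in $K(n,P)$, and assume $\alpha=\gamma$. The threshold for the appearance of $T$ in $K(n,P)$ is $2(\alpha+\beta)^{e(T)}=1$; that is, if $2(\alpha+\beta)^{e(T)}<1$ then a.a.s. $K(n,P)$ contains no copy of $T$, and if $2(\alpha+\beta)^{e(T)}>1$ then a.a.s. \[X_T=(1+o(1))\left(2(\alpha+\beta)^{e(T)}\right)^n .\]
   Context: Let $0<\alpha,\beta,\gamma<1$ be constants not depending on $n$, and $P=\begin{pmatrix}\alpha&\beta\\ \beta&\gamma\end{pmatrix}$ indexed by $\{0,1\}$ ($P_{1,1}=\alpha$, $P_{0,1}=P_{1,0}=\beta$, $P_{0,0}=\gamma$). The stochastic Kronecker graph $K(n,P)$ has vertex set $\mathbb Z_2^n$; writing $u_k$ for the $k$-th digit of $u$, each pair $\{u,v\}$ is an edge with probability $p_{u,v}=\prod_{k=1}^n P_{u_k,v_k}$, independently of all other pairs. A labeled copy of a graph $G$ is an injective map $V(G)\to\mathbb Z_2^n$ mapping every edge of $G$ to an edge of $K(n,P)$. A.a.s. means with probability tending to $1$ as $n\to\infty$. *)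

theory Defs
  imports "HOL-Probability.Probability" "HOL-Library.Ramsey" "HOL-Library.Z2"
begin

text \<open>A finite simple graph is given by its vertex set \<open>V\<close> and a set \<open>E\<close> of two-element
  subsets of \<open>V\<close>.\<close>

definition simple_graph :: "'a set \<Rightarrow> 'a set set \<Rightarrow> bool" where
  "simple_graph V E \<longleftrightarrow> finite V \<and> E \<subseteq> [V]\<^bsup>2\<^esup>"

definition graph_connected :: "'a set \<Rightarrow> 'a set set \<Rightarrow> bool" where
  "graph_connected V E \<longleftrightarrow> V \<noteq> {} \<and> (\<forall>u\<in>V. \<forall>v\<in>V. (u, v) \<in> {(x, y). {x, y} \<in> E}\<^sup>*)"

definition graph_cycle :: "'a set set \<Rightarrow> 'a list \<Rightarrow> bool" where
  "graph_cycle E c \<longleftrightarrow> length c \<ge> 3 \<and> distinct c \<and>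
     (\<forall>i<length c. {c ! i, c ! (Suc i mod length c)} \<in> E)"

definition tree_graph :: "'a set \<Rightarrow> 'a set set \<Rightarrow> bool" where
  "tree_graph V E \<longleftrightarrow> simple_graph V E \<and> graph_connected V E \<and> (\<nexists>c. graph_cycle E c)"

definition kron_vertices :: "nat \<Rightarrow> (nat \<Rightarrow> bit) set" where
  "kron_vertices n = {1..n} \<rightarrow>\<^sub>E UNIV"

definition kron_matrix :: "real \<Rightarrow> real \<Rightarrow> real \<Rightarrow> bit \<Rightarrow> bit \<Rightarrow> real" where
  "kron_matrix \<alpha> \<beta> \<gamma> i j =
     (if i = 1 \<and> j = 1 then \<alpha> else if i = 0 \<and> j = 0 then \<gamma> else \<beta>)"

definition kron_prob :: "nat \<Rightarrow> (bit \<Rightarrow> bit \<Rightarrow> real) \<Rightarrow> (nat \<Rightarrow> bit) \<Rightarrow> (nat \<Rightarrow> bit) \<Rightarrow> real" where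
  "kron_prob n P u v = (\<Prod>k=1..n. P (u k) (v k))"

text \<open>The same probability as a function of the unordered pair; it is well defined for symmetric
  \<open>P\<close>, as the lemma below shows.\<close>

definition kron_edge_prob :: "nat \<Rightarrow> (bit \<Rightarrow> bit \<Rightarrow> real) \<Rightarrow> (nat \<Rightarrow> bit) set \<Rightarrow> real" where
  "kron_edge_prob n P e = (THE p. \<exists>u v. e = {u, v} \<and> p = kron_prob n P u v)"

lemma kron_edge_prob_doubleton:
  assumes "\<And>i j. P i j = P j i"
  shows "kron_edge_prob n P {u, v} = kron_prob n P u v"
proof -
  have "kron_prob n P v u = kron_prob n P u v"
    unfolding kron_prob_def by (intro prod.cong refl assms)
  then show ?thesis
    unfolding kron_edge_prob_def by (intro the_equality) (auto simp: doubleton_eq_iff)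
qed

lemma kron_matrix_sym: "kron_matrix \<alpha> \<beta> \<gamma> i j = kron_matrix \<alpha> \<beta> \<gamma> j i"
  by (auto simp: kron_matrix_def)

text \<open>The law of the random edge set of \<open>K(n,P)\<close>: one independent Bernoulli variable for each
  unordered pair of distinct vertices.\<close>

definition kronecker_graph :: "nat \<Rightarrow> (bit \<Rightarrow> bit \<Rightarrow> real) \<Rightarrow> (nat \<Rightarrow> bit) set set pmf" where
  "kronecker_graph n P =
     map_pmf (\<lambda>\<omega>. {e \<in> [kron_vertices n]\<^bsup>2\<^esup>. \<omega> e})
       (Pi_pmf ([kron_vertices n]\<^bsup>2\<^esup>) False (\<lambda>e. bernoulli_pmf (kron_edge_prob n P e)))"

text \<open>Labeled copies are extensional functions, so that distinct elements of this set differ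
  on \<open>V\<close> and its cardinality is the number of copies.\<close>

definition labeled_copies ::
    "'a set \<Rightarrow> 'a set set \<Rightarrow> nat \<Rightarrow> (nat \<Rightarrow> bit) set set \<Rightarrow> ('a \<Rightarrow> nat \<Rightarrow> bit) set" where
  "labeled_copies V E n G =
     {f \<in> V \<rightarrow>\<^sub>E kron_vertices n. inj_on f V \<and> (\<forall>e\<in>E. f ` e \<in> G)}"

definition num_copies :: "'a set \<Rightarrow> 'a set set \<Rightarrow> nat \<Rightarrow> (nat \<Rightarrow> bit) set set \<Rightarrow> nat" where
  "num_copies V E n G = card (labeled_copies V E n G)"

definition aas :: "(nat \<Rightarrow> 'g pmf) \<Rightarrow> (nat \<Rightarrow> 'g \<Rightarrow> bool) \<Rightarrow> bool" where
  "aas M Q \<longleftrightarrow> (\<lambda>n. measure_pmf.prob (M n) {G. Q n G}) \<longlonglongrightarrow> 1"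

text \<open>\<open>X = (1 + o(1)) f\<close> asymptotically almost surely, with a deterministic \<open>o(1)\<close> error bound.\<close>

definition aas_asymp :: "(nat \<Rightarrow> 'g pmf) \<Rightarrow> (nat \<Rightarrow> 'g \<Rightarrow> real) \<Rightarrow> (nat \<Rightarrow> real) \<Rightarrow> bool" where
  "aas_asymp M X f \<longleftrightarrow>
     (\<exists>\<delta>. \<delta> \<longlonglongrightarrow> 0 \<and> aas M (\<lambda>n G. \<exists>\<epsilon>. \<bar>\<epsilon>\<bar> \<le> \<delta> n \<and> X n G = (1 + \<epsilon>) * f n))"

end

theory Submission
  imports Defs
begin

text \<open>
  Write \<open>d = \<alpha> + \<beta>\<close> and \<open>\<mu> = 2 d ^ e(T)\<close>. For \<open>\<alpha> = \<gamma>\<close> the edge probabilities seen from any vertex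
  sum to \<open>d ^ n\<close> (loops included), so summing out one leaf of \<open>T\<close> after another shows that all maps
  \<open>V(T) \<rightarrow> \<int>\<^sub>2\<^sup>n\<close> have total weight exactly \<open>\<mu> ^ n\<close>. The first claim is the first moment method.

  For the second, non-injective maps contribute only a fraction \<open>O((max \<alpha> \<beta> / d) ^ n)\<close>, because a single
  pair has weight at most \<open>max \<alpha> \<beta> ^ n\<close>. In the second moment, pairs of copies with disjoint vertex sets
  contribute at most \<open>(\<mu> ^ n)\<^sup>2\<close>. Given a copy \<open>f\<close>, a second copy that meets it in \<open>s \<ge> 1\<close> vertices can be grown
  from the shared vertices, using one new edge for every new vertex, hence adds a factor of at most
  \<open>O((d ^ n) ^ (e(T) + 1 - s)) = O(max 1 (d ^ e(T)) ^ n)\<close>, which is \<open>o(\<mu> ^ n)\<close> since \<open>\<mu> > 1\<close>.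
\<close>

section \<open>Trees grown by adding leaves\<close>

text \<open>Trees in a form suited to induction: the last vertex \<open>b\<close> carries a single
  edge, so a sum over maps can be evaluated by summing out the value at \<open>b\<close>
  first.\<close>

inductive grown_tree :: "'a set \<Rightarrow> 'a set set \<Rightarrow> bool" where
  singleton: "grown_tree {x} {}"
| leaf: "grown_tree V E \<Longrightarrow> a \<in> V \<Longrightarrow> b \<notin> V \<Longrightarrow> grown_tree (insert b V) (insert {a, b} E)"

lemma grown_tree_finite: "grown_tree V E \<Longrightarrow> finite V \<and> finite E"
  by (induction rule: grown_tree.induct) auto

lemma grown_tree_nonempty: "grown_tree V E \<Longrightarrow> V \<noteq> {}"
  by (induction rule: grown_tree.induct) auto

lemma grown_tree_edges_subset: "grown_tree V E \<Longrightarrow> e \<in> E \<Longrightarrow> e \<subseteq> V"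
  by (induction arbitrary: e rule: grown_tree.induct) auto

lemma grown_tree_edges_nsets: "grown_tree V E \<Longrightarrow> E \<subseteq> [V]\<^bsup>2\<^esup>"
proof (induction rule: grown_tree.induct)
  case (leaf V E a b)
  then have "{a, b} \<in> [insert b V]\<^bsup>2\<^esup>" by (auto simp: nsets_def card_2_iff)
  moreover have "[V]\<^bsup>2\<^esup> \<subseteq> [insert b V]\<^bsup>2\<^esup>" by (auto simp: nsets_def)
  ultimately show ?case using leaf.IH by blast
qed simp

lemma grown_tree_leaf_edge_notin: "grown_tree V E \<Longrightarrow> b \<notin> V \<Longrightarrow> {a, b} \<notin> E"
  using grown_tree_edges_subset by fastforce

lemma grown_tree_card: "grown_tree V E \<Longrightarrow> card V = Suc (card E)"
proof (induction rule: grown_tree.induct)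
  case (leaf V E a b)
  then show ?case
    using grown_tree_leaf_edge_notin[of V E b a] grown_tree_finite[of V E] by simp
qed simp

section \<open>Paths in a grown tree\<close>

definition simple_path :: "'a set set \<Rightarrow> 'a list \<Rightarrow> bool" where
  "simple_path E p \<longleftrightarrow> p \<noteq> [] \<and> distinct p \<and> (\<forall>i. Suc i < length p \<longrightarrow> {p ! i, p ! Suc i} \<in> E)"

lemma simple_path_mono: "simple_path E p \<Longrightarrow> E \<subseteq> F \<Longrightarrow> simple_path F p"
  by (auto simp: simple_path_def)

lemma simple_path_snoc:
  assumes "simple_path E p" "{last p, b} \<in> E" "b \<notin> set p"
  shows "simple_path E (p @ [b])"
proof -
  have "{(p @ [b]) ! i, (p @ [b]) ! Suc i} \<in> E" if "Suc i < length (p @ [b])" for i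
  proof (cases "Suc i < length p")
    case True
    then show ?thesis using assms(1) by (simp add: simple_path_def nth_append)
  next
    case False
    then have "i = length p - 1" "p \<noteq> []" "Suc i = length p"
      using that assms(1) by (auto simp: simple_path_def)
    then show ?thesis
      using assms(2) by (simp add: nth_append last_conv_nth)
  qed
  then show ?thesis using assms by (auto simp: simple_path_def)
qed

lemma simple_path_rev:
  assumes "simple_path E p"
  shows "simple_path E (rev p)"
proof -
  have "{rev p ! i, rev p ! Suc i} \<in> E" if "Suc i < length p" for i
  proof -
    let ?j = "length p - Suc (Suc i)"
    have "{p ! ?j, p ! Suc ?j} \<in> E"
      using assms that by (simp add: simple_path_def)
    moreover have "Suc ?j = length p - Suc i" using that by simp
    ultimately show ?thesis using that by (simp add: rev_nth insert_commute)
  qed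
  then show ?thesis using assms by (auto simp: simple_path_def)
qed

text \<open>Besides the trivial path, only paths with the new leaf \<open>b\<close> as an end are
  new: a path to \<open>a\<close> in the old tree is continued by \<open>b\<close>, and reversal
  covers those that start at \<open>b\<close>.\<close>

lemma grown_tree_simple_path:
  "grown_tree V E \<Longrightarrow> u \<in> V \<Longrightarrow> v \<in> V \<Longrightarrow>
     \<exists>p. simple_path E p \<and> set p \<subseteq> V \<and> hd p = u \<and> last p = v"
proof (induction arbitrary: u v rule: grown_tree.induct)
  case (singleton x)
  then show ?case by (intro exI[of _ "[x]"]) (auto simp: simple_path_def)
next
  case (leaf V E a b)
  have to_leaf: "\<exists>p. simple_path (insert {a, b} E) p \<and> set p \<subseteq> insert b V \<and> hd p = x \<and> last p = b"
    if xV: "x \<in> V" for x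
  proof -
    obtain p where p: "simple_path E p" "set p \<subseteq> V" "hd p = x" "last p = a"
      using leaf.IH[OF xV leaf.hyps(2)] by blast
    have "simple_path (insert {a, b} E) (p @ [b])"
      using p leaf.hyps by (intro simple_path_snoc simple_path_mono[OF p(1)]) auto
    moreover have "p \<noteq> []" using p(1) by (auto simp: simple_path_def)
    ultimately show ?thesis
      using p by (intro exI[of _ "p @ [b]"]) auto
  qed
  consider "u = b" "v = b" | "u \<in> V" "v = b" | "u = b" "v \<in> V" | "u \<in> V" "v \<in> V"
    using leaf.prems by blast
  then show ?case
  proof cases
    case 1
    then show ?thesis by (intro exI[of _ "[b]"]) (auto simp: simple_path_def)
  next
    case 2
    then show ?thesis using to_leaf by blast
  next
    case 3
    then obtain p where "simple_path (insert {a, b} E) p" "set p \<subseteq> insert b V" "hd p = v" "last p = b"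
      using to_leaf by blast
    then show ?thesis
      using 3 simple_path_rev[of "insert {a, b} E" p]
      by (intro exI[of _ "rev p"]) (auto simp: hd_rev last_rev)
  next
    case 4
    then obtain p where "simple_path E p" "set p \<subseteq> V" "hd p = u" "last p = v"
      using leaf.IH by blast
    then show ?thesis
      using simple_path_mono[of E p "insert {a, b} E"] by blast
  qed
qed

section \<open>Trees are grown trees\<close>

lemma connected_crossing_edge:
  assumes "graph_connected V E" "E \<subseteq> [V]\<^bsup>2\<^esup>" "S \<subseteq> V" "S \<noteq> {}" "S \<noteq> V"
  obtains a b where "{a, b} \<in> E" "a \<in> S" "b \<in> V" "b \<notin> S"
proof -
  obtain u v where uv: "u \<in> S" "v \<in> V" "v \<notin> S" using assms by blast
  have "(u, v) \<in> {(x, y). {x, y} \<in> E}\<^sup>*"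
    using assms uv by (auto simp: graph_connected_def)
  \<comment> \<open>A walk that starts in \<open>S\<close> must step out of \<open>S\<close> before
    it reaches a vertex outside.\<close>
  then have "v \<notin> S \<Longrightarrow> \<exists>a b. {a, b} \<in> E \<and> a \<in> S \<and> b \<notin> S"
    by (induction rule: rtrancl_induct) (use uv in auto)
  then obtain a b where "{a, b} \<in> E" "a \<in> S" "b \<notin> S" using uv by blast
  moreover from this have "b \<in> V" using assms(2) by (auto simp: nsets_def)
  ultimately show thesis using that by blast
qed

text \<open>A maximal vertex set carrying a grown tree with edges from \<open>E\<close> is all of
  \<open>V\<close>, because an edge leaving it would add one more leaf.\<close>

lemma connected_spanning_grown_tree:
  assumes "graph_connected V E" "E \<subseteq> [V]\<^bsup>2\<^esup>" "finite V"
  obtains F where "grown_tree V F" "F \<subseteq> E"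
proof -
  define Q where "Q = {S. S \<subseteq> V \<and> (\<exists>F \<subseteq> E. grown_tree S F)}"
  obtain x where "x \<in> V" using assms by (auto simp: graph_connected_def)
  then have "{x} \<in> Q"
    unfolding Q_def using grown_tree.singleton[of x] by (auto intro!: exI[of _ "{}"])
  then have "Q \<noteq> {}" by blast
  moreover have "finite Q"
    by (rule finite_subset[of _ "Pow V"]) (use assms(3) in \<open>auto simp: Q_def\<close>)
  ultimately obtain S where SQ: "S \<in> Q" and maximal: "\<And>S'. S' \<in> Q \<Longrightarrow> S \<subseteq> S' \<Longrightarrow> S = S'"
    using finite_has_maximal[of Q] by blast
  obtain F where F: "F \<subseteq> E" "grown_tree S F" and SV: "S \<subseteq> V"
    using SQ by (auto simp: Q_def)
  have "S = V"
  proof (rule ccontr)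
    assume "S \<noteq> V"
    then obtain a b where ab: "{a, b} \<in> E" "a \<in> S" "b \<in> V" "b \<notin> S"
      using connected_crossing_edge[OF assms(1,2) SV grown_tree_nonempty[OF F(2)]] by metis
    then have "insert b S \<in> Q"
      unfolding Q_def using SV F(1) ab grown_tree.leaf[OF F(2) ab(2,4)]
      by (auto intro!: exI[of _ "insert {a, b} F"])
    then show False using maximal[of "insert b S"] ab by auto
  qed
  then show thesis using that F by blast
qed

text \<open>A spanning grown tree \<open>F\<close> already has all edges: an edge of
  \<open>E\<close> outside \<open>F\<close> would close the \<open>F\<close>-path between its ends
  to a cycle.\<close>

lemma tree_graph_grown_tree:
  assumes "tree_graph V E"
  shows "grown_tree V E"
proof -
  have E: "graph_connected V E" "E \<subseteq> [V]\<^bsup>2\<^esup>" "finite V" "\<nexists>c. graph_cycle E c"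
    using assms by (auto simp: tree_graph_def simple_graph_def)
  obtain F where F: "grown_tree V F" "F \<subseteq> E"
    using connected_spanning_grown_tree[OF E(1-3)] by blast
  have "E \<subseteq> F"
  proof
    fix e assume e: "e \<in> E"
    then have "e \<subseteq> V" "card e = 2" using E(2) by (auto simp: nsets_def)
    then obtain u v where uv: "e = {u, v}" "u \<noteq> v" "u \<in> V" "v \<in> V"
      by (auto simp: card_2_iff)
    then obtain p where p: "simple_path F p" "hd p = u" "last p = v"
      using grown_tree_simple_path[OF F(1)] by blast
    have p0: "p \<noteq> []" "distinct p" using p(1) by (auto simp: simple_path_def)
    show "e \<in> F"
    proof (rule ccontr)
      assume "e \<notin> F"
      have ends: "p ! 0 = u" "p ! (length p - 1) = v"
        using p p0 by (auto simp: hd_conv_nth last_conv_nth)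
      \<comment> \<open>One vertex would identify the two ends of \<open>e\<close>, and two vertices
        would put \<open>e\<close> into \<open>F\<close>; so the path has the three vertices that
        \<open>graph_cycle\<close> demands.\<close>
      have "length p \<noteq> 1" using ends uv(2) by auto
      moreover have "length p \<noteq> 2"
      proof
        assume "length p = 2"
        then have "{p ! 0, p ! Suc 0} \<in> F" using p(1) by (auto simp: simple_path_def)
        then show False using ends \<open>length p = 2\<close> \<open>e \<notin> F\<close> uv(1) by simp
      qed
      moreover have "length p \<noteq> 0" using p0 by simp
      ultimately have len: "length p \<ge> 3" by linarith
      have "{p ! i, p ! (Suc i mod length p)} \<in> E" if "i < length p" for i
      proof (cases "Suc i < length p")
        case True
        then show ?thesis using p(1) F(2) by (auto simp: simple_path_def)
      next
        case False
        \<comment> \<open>At the last index the successor wraps around to \<open>0\<close>, and the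
          closing edge is \<open>e\<close>.\<close>
        then have "Suc i = length p" "i = length p - 1" using that by auto
        then show ?thesis using ends e uv(1) by (simp add: insert_commute)
      qed
      then have "graph_cycle E p" using len p0 by (simp add: graph_cycle_def)
      then show False using E(4) by blast
    qed
  qed
  then show ?thesis using F by auto
qed

section \<open>Weighted maps of a tree\<close>

lemma sum_PiE_insert:
  assumes "b \<notin> V"
  shows "(\<Sum>f\<in>insert b V \<rightarrow>\<^sub>E K. h f) = (\<Sum>f\<in>V \<rightarrow>\<^sub>E K. \<Sum>v\<in>K. h (f(b := v)))"
proof -
  have "(\<Sum>f\<in>insert b V \<rightarrow>\<^sub>E K. h f) = (\<Sum>(v, f)\<in>K \<times> (V \<rightarrow>\<^sub>E K). h (f(b := v)))"
    unfolding PiE_insert_eq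
    by (subst sum.reindex) (use inj_combinator[OF assms, of "\<lambda>_. K"] in \<open>auto simp: case_prod_unfold\<close>)
  also have "\<dots> = (\<Sum>v\<in>K. \<Sum>f\<in>V \<rightarrow>\<^sub>E K. h (f(b := v)))"
    by (rule sum.cartesian_product[symmetric])
  also have "\<dots> = (\<Sum>f\<in>V \<rightarrow>\<^sub>E K. \<Sum>v\<in>K. h (f(b := v)))"
    by (rule sum.swap)
  finally show ?thesis .
qed

text \<open>Choosing one class \<open>c x\<close> for each \<open>x\<close> partitions
  \<open>A\<close>; elements lying in several \<open>B i\<close> only enlarge the right-hand side.
  The bound \<open>h i\<close> may depend on the class.\<close>

lemma sum_le_sum_cover:
  fixes t :: "'a \<Rightarrow> real"
  assumes "finite A" "finite I" "\<And>i. i \<in> I \<Longrightarrow> finite (B i)"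
    and "\<And>x. x \<in> A \<Longrightarrow> \<exists>i\<in>I. x \<in> B i \<and> t x \<le> h i x"
    and "\<And>i x. i \<in> I \<Longrightarrow> x \<in> B i \<Longrightarrow> 0 \<le> h i x"
  shows "sum t A \<le> (\<Sum>i\<in>I. sum (h i) (B i))"
proof -
  obtain c where c: "\<And>x. x \<in> A \<Longrightarrow> c x \<in> I \<and> x \<in> B (c x) \<and> t x \<le> h (c x) x"
    using assms(4) by metis
  have "sum t A = (\<Sum>i\<in>I. sum t {x \<in> A. c x = i})"
    using sum.group[of A I c t] assms(1,2) c by (auto simp: image_subset_iff)
  also have "\<dots> \<le> (\<Sum>i\<in>I. sum (h i) (B i))"
  proof (rule sum_mono)
    fix i assume i: "i \<in> I"
    have "sum t {x \<in> A. c x = i} \<le> sum (h i) {x \<in> A. c x = i}"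
      by (rule sum_mono) (use c in auto)
    also have "\<dots> \<le> sum (h i) (B i)"
      by (rule sum_mono2) (use c i assms in auto)
    finally show "sum t {x \<in> A. c x = i} \<le> sum (h i) (B i)" .
  qed
  finally show ?thesis .
qed

text \<open>All that the moment bounds use about the Kronecker weights. The row sum runs over all of
  \<open>K\<close>, so it includes the loop weight \<open>w {u}\<close>. For the Kronecker graph,
  \<open>D\<close> is \<alpha> + \<beta> and \<open>m\<close> is
  \<open>max \<alpha> \<beta>\<close>, both raised to the power \<open>n\<close>.\<close>

locale regular_weight =
  fixes K :: "'b set" and w :: "'b set \<Rightarrow> real" and D m :: real
  assumes finite_K: "finite K"
    and w_nonneg: "u \<in> K \<Longrightarrow> v \<in> K \<Longrightarrow> 0 \<le> w {u, v}"
    and w_le_1: "u \<in> K \<Longrightarrow> v \<in> K \<Longrightarrow> w {u, v} \<le> 1"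
    and w_le: "u \<in> K \<Longrightarrow> v \<in> K \<Longrightarrow> w {u, v} \<le> m"
    and w_sum: "u \<in> K \<Longrightarrow> (\<Sum>v\<in>K. w {u, v}) = D"
    and D_pos: "0 < D"
    and m_nonneg: "0 \<le> m"
begin

text \<open>For an injective map this is the probability that it is a copy. For other maps it is a
  formal product, in which loops carry weight and coinciding image edges count repeatedly.\<close>

definition hom_weight :: "'a set set \<Rightarrow> ('a \<Rightarrow> 'b) \<Rightarrow> real" where
  "hom_weight E f = (\<Prod>e\<in>E. w (f ` e))"

lemma w_image_bounds:
  assumes "f \<in> V \<rightarrow> K" "e \<in> [V]\<^bsup>2\<^esup>"
  shows "0 \<le> w (f ` e)" "w (f ` e) \<le> 1"
proof -
  obtain u v where uv: "e = {u, v}" "u \<in> V" "v \<in> V"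
    using assms(2) by (auto simp: nsets_def card_2_iff)
  then have "f u \<in> K" "f v \<in> K" using assms(1) by auto
  then show "0 \<le> w (f ` e)" "w (f ` e) \<le> 1"
    using uv w_nonneg w_le_1 by auto
qed

lemma hom_weight_bounds:
  assumes "f \<in> V \<rightarrow> K" "E \<subseteq> [V]\<^bsup>2\<^esup>"
  shows "0 \<le> hom_weight E f" "hom_weight E f \<le> 1"
  unfolding hom_weight_def using w_image_bounds[OF assms(1)] assms(2)
  by (auto intro!: prod_nonneg prod_le_1)

lemma hom_weight_leaf:
  assumes "grown_tree V E" "a \<in> V" "b \<notin> V"
  shows "hom_weight (insert {a, b} E) (f(b := v)) = w {f a, v} * hom_weight E f"
proof -
  have "f(b := v) ` e = f ` e" if "e \<in> E" for e
    using grown_tree_edges_subset[OF assms(1) that] assms(3) by (intro image_cong) auto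
  moreover have "f(b := v) ` {a, b} = {f a, v}" using assms by auto
  ultimately show ?thesis
    unfolding hom_weight_def
    using grown_tree_finite[OF assms(1)] grown_tree_leaf_edge_notin[OF assms(1,3)]
    by (simp del: image_insert fun_upd_apply cong: prod.cong)
qed

text \<open>Summing out the leaf gives the factor \<open>D\<close> wherever its neighbour is mapped;
  the single vertex at the start contributes \<open>card K\<close>.\<close>

lemma sum_hom_weight_tree:
  "grown_tree V E \<Longrightarrow> (\<Sum>f\<in>V \<rightarrow>\<^sub>E K. hom_weight E f) = card K * D ^ card E"
proof (induction rule: grown_tree.induct)
  case (singleton x)
  have "card ({x} \<rightarrow>\<^sub>E K) = card K" by (simp add: card_PiE)
  then show ?case by (simp add: hom_weight_def)
next
  case (leaf V E a b)
  have "(\<Sum>f\<in>insert b V \<rightarrow>\<^sub>E K. hom_weight (insert {a, b} E) f)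
      = (\<Sum>f\<in>V \<rightarrow>\<^sub>E K. (\<Sum>v\<in>K. w {f a, v}) * hom_weight E f)"
    using leaf.hyps by (simp add: sum_PiE_insert hom_weight_leaf sum_distrib_right)
  also have "\<dots> = (\<Sum>f\<in>V \<rightarrow>\<^sub>E K. D * hom_weight E f)"
    using w_sum leaf.hyps(2) by (intro sum.cong refl arg_cong2[of _ _ _ _ "(*)"]) (blast intro: PiE_mem)
  also have "\<dots> = card K * D ^ Suc (card E)"
    by (simp add: sum_distrib_left[symmetric] leaf.IH)
  finally show ?case
    using grown_tree_leaf_edge_notin[OF leaf.hyps(1,3), of a] grown_tree_finite[OF leaf.hyps(1)] by simp
qed

text \<open>Adding a leaf \<open>b\<close> at \<open>a\<close>, a map that is injective so far becomes non-injective only by sending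
  \<open>b\<close> to one of the \<open>card V\<close> used vertices, each of which has weight at most \<open>m\<close>.\<close>

lemma sum_noninj_hom_weight_tree:
  "grown_tree V E \<Longrightarrow>
     (\<Sum>f\<in>V \<rightarrow>\<^sub>E K. if inj_on f V then 0 else hom_weight E f)
       \<le> (card V)\<^sup>2 * (card K * D ^ card E) * (m / D)"
proof (induction rule: grown_tree.induct)
  case (singleton x)
  then show ?case using m_nonneg D_pos by (simp add: sum.neutral)
next
  case (leaf V E a b)
  let ?c = "real (card V)" and ?\<mu> = "card K * D ^ card E"
  have fin: "finite V" "finite E" using grown_tree_finite[OF leaf.hyps(1)] by auto
  have card_E: "card (insert {a, b} E) = Suc (card E)"
    using fin grown_tree_leaf_edge_notin[OF leaf.hyps(1,3), of a] by simp
  \<comment> \<open>The first term serves maps that are non-injective already: all values at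
    \<open>b\<close> count, and their weights sum to \<open>D\<close>.\<close>
  have step: "(\<Sum>v\<in>K. if inj_on (f(b := v)) (insert b V) then 0 else hom_weight (insert {a, b} E) (f(b := v)))
      \<le> D * (if inj_on f V then 0 else hom_weight E f) + ?c * m * hom_weight E f"
    if f: "f \<in> V \<rightarrow>\<^sub>E K" for f
  proof -
    have fa: "f a \<in> K" using f leaf.hyps by auto
    have nonneg: "0 \<le> hom_weight E f"
      using hom_weight_bounds(1)[OF _ grown_tree_edges_nsets[OF leaf.hyps(1)]] f by (auto simp: PiE_def)
    have inj: "inj_on (f(b := v)) (insert b V) \<longleftrightarrow> inj_on f V \<and> v \<notin> f ` V" for v
      using leaf.hyps(3) by (auto simp: inj_on_def)
    show ?thesis
    proof (cases "inj_on f V")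
      case True
      have "(\<Sum>v\<in>K. if inj_on (f(b := v)) (insert b V) then 0 else hom_weight (insert {a, b} E) (f(b := v)))
          = (\<Sum>v\<in>K. if v \<in> f ` V then w {f a, v} * hom_weight E f else 0)"
        unfolding inj hom_weight_leaf[OF leaf.hyps] using True by (intro sum.cong refl) simp
      also have "\<dots> = (\<Sum>v\<in>K \<inter> f ` V. w {f a, v} * hom_weight E f)"
        using finite_K by (simp add: sum.inter_restrict)
      also have "\<dots> \<le> (\<Sum>v\<in>K \<inter> f ` V. m * hom_weight E f)"
        using fa w_le nonneg by (intro sum_mono mult_right_mono) auto
      also have "\<dots> = card (K \<inter> f ` V) * (m * hom_weight E f)" by simp
      also have "\<dots> \<le> ?c * (m * hom_weight E f)"
      proof (intro mult_right_mono)
        have "card (K \<inter> f ` V) \<le> card (f ` V)" using fin by (intro card_mono) auto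
        also have "\<dots> \<le> card V" using fin by (intro card_image_le)
        finally show "real (card (K \<inter> f ` V)) \<le> ?c" by simp
      qed (use m_nonneg nonneg in auto)
      finally show ?thesis using True by simp
    next
      case False
      then have "(\<Sum>v\<in>K. if inj_on (f(b := v)) (insert b V) then 0 else hom_weight (insert {a, b} E) (f(b := v)))
          = (\<Sum>v\<in>K. w {f a, v}) * hom_weight E f"
        unfolding inj hom_weight_leaf[OF leaf.hyps] by (simp add: sum_distrib_right)
      then show ?thesis using False w_sum[OF fa] nonneg m_nonneg by simp
    qed
  qed
  have "(\<Sum>f\<in>insert b V \<rightarrow>\<^sub>E K. if inj_on f (insert b V) then 0 else hom_weight (insert {a, b} E) f)
      \<le> (\<Sum>f\<in>V \<rightarrow>\<^sub>E K. D * (if inj_on f V then 0 else hom_weight E f) + ?c * m * hom_weight E f)"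
    unfolding sum_PiE_insert[OF leaf.hyps(3)] by (intro sum_mono step)
  also have "\<dots> = D * (\<Sum>f\<in>V \<rightarrow>\<^sub>E K. if inj_on f V then 0 else hom_weight E f) + ?c * m * ?\<mu>"
    by (simp only: sum.distrib sum_distrib_left[symmetric] sum_hom_weight_tree[OF leaf.hyps(1)])
  also have "\<dots> \<le> D * ((card V)\<^sup>2 * ?\<mu> * (m / D)) + ?c * m * ?\<mu>"
    using leaf.IH D_pos by (intro add_right_mono mult_left_mono) auto
  also have "\<dots> = (?c\<^sup>2 + ?c) * (m * ?\<mu>)"
    using D_pos by (simp add: field_simps)
  \<comment> \<open>\<open>?c + 1\<close> is the size of \<open>insert b V\<close>, so the squared
    vertex count absorbs the additional error \<open>?c\<close>.\<close>
  also have "\<dots> \<le> (?c + 1)\<^sup>2 * (m * ?\<mu>)"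
    using m_nonneg D_pos by (intro mult_right_mono) (auto simp: power2_eq_square algebra_simps)
  also have "\<dots> = (card (insert b V))\<^sup>2 * (card K * D ^ card (insert {a, b} E)) * (m / D)"
    unfolding card_E using fin leaf.hyps(3) D_pos by (simp add: add.commute)
  finally show ?case .
qed

text \<open>The product set fixes \<open>g\<close> to be \<open>g0\<close> on \<open>S\<close>.
  Connectivity supplies an edge from \<open>S\<close> to a new vertex; summing over the value there
  gives \<open>D\<close>, and the process repeats until \<open>S\<close> is
  \<open>V\<close>.\<close>

lemma sum_extension_weight_le:
  assumes "graph_connected V E" "E \<subseteq> [V]\<^bsup>2\<^esup>" "finite V" "S \<subseteq> V" "S \<noteq> {}" "g0 \<in> S \<rightarrow> K"
  shows "(\<Sum>g\<in>PiE V (\<lambda>x. if x \<in> S then {g0 x} else K). hom_weight {e \<in> E. \<not> e \<subseteq> S} g)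
           \<le> D ^ card (V - S)"
  using assms(4-6)
proof (induction "card (V - S)" arbitrary: S g0)
  case 0
  then have "S = V" using assms(3) by auto
  then have "{e \<in> E. \<not> e \<subseteq> S} = {}" using assms(2) by (auto simp: nsets_def)
  moreover have "card (PiE V (\<lambda>x. if x \<in> S then {g0 x} else K)) = 1"
    using assms(3) \<open>S = V\<close> by (simp add: card_PiE)
  ultimately show ?case using 0(1) unfolding hom_weight_def by (simp only: prod.empty) simp
next
  case (Suc k)
  have finE: "finite E" using assms(2,3) finite_subset finite_imp_finite_nsets by metis
  have "S \<noteq> V" using Suc.hyps(2) by auto
  then obtain a b where ab: "{a, b} \<in> E" "a \<in> S" "b \<in> V" "b \<notin> S"
    using connected_crossing_edge[OF assms(1,2) Suc.prems(1,2)] by metis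
  let ?B = "\<lambda>S g0. PiE V (\<lambda>x. if x \<in> S then {g0 x} else K)"
  let ?S = "insert b S"
  have card: "card (V - ?S) = k" "card (V - S) = Suc k"
  proof -
    have "V - ?S = (V - S) - {b}" by auto
    then show "card (V - ?S) = k" using Suc.hyps(2) ab assms(3) by simp
  qed (use Suc.hyps(2) in simp)
  have g0: "g0 x \<in> K" if "x \<in> S" for x using Suc.prems(3) that by auto
  have sub: "{g \<in> ?B S g0. g b = v} = ?B ?S (g0(b := v))" if "v \<in> K" for v
  proof -
    have "g \<in> ?B ?S (g0(b := v)) \<longleftrightarrow> g \<in> ?B S g0 \<and> g b = v" for g
      using ab that by (auto simp: PiE_iff split: if_splits)
    then show ?thesis by blast
  qed
  have split: "hom_weight {e \<in> E. \<not> e \<subseteq> S} g \<le> w {g0 a, v} * hom_weight {e \<in> E. \<not> e \<subseteq> ?S} g"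
    if v: "v \<in> K" and g: "g \<in> ?B ?S (g0(b := v))" for v g
  proof -
    have gVK: "g \<in> V \<rightarrow> K"
      using g g0 v by (auto simp: PiE_iff split: if_splits)
    have gab: "g a = g0 a" "g b = v"
      using g ab Suc.prems(1) by (auto simp: PiE_iff split: if_splits)
    \<comment> \<open>The edges that \<open>S\<close> absorbs together with \<open>b\<close>. Only
      \<open>{a, b}\<close> is kept, for the row sum at \<open>g0 a\<close>; the others are bounded
      by 1.\<close>
    let ?N = "{e \<in> E. \<not> e \<subseteq> S \<and> e \<subseteq> ?S}"
    have "hom_weight {e \<in> E. \<not> e \<subseteq> S} g = hom_weight ?N g * hom_weight {e \<in> E. \<not> e \<subseteq> ?S} g"
      unfolding hom_weight_def using finE
      by (subst prod.union_disjoint[symmetric]) (auto intro!: prod.cong)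
    also have "hom_weight ?N g = w (g ` {a, b}) * hom_weight (?N - {{a, b}}) g"
      unfolding hom_weight_def using finE ab by (intro prod.remove) auto
    also have "\<dots> \<le> w (g ` {a, b}) * 1"
      using hom_weight_bounds(2)[OF gVK, of "?N - {{a, b}}"] w_image_bounds(1)[OF gVK, of "{a, b}"]
        assms(2) ab(1)
      by (intro mult_left_mono) auto
    also have "\<dots> = w {g0 a, v}" using gab by simp
    finally show ?thesis
      using hom_weight_bounds(1)[OF gVK, of "{e \<in> E. \<not> e \<subseteq> ?S}"] assms(2)
      by (auto intro: mult_right_mono)
  qed
  have "(\<Sum>g\<in>?B S g0. hom_weight {e \<in> E. \<not> e \<subseteq> S} g)
      = (\<Sum>v\<in>K. \<Sum>g | g \<in> ?B S g0 \<and> g b = v. hom_weight {e \<in> E. \<not> e \<subseteq> S} g)"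
    using ab assms(3) finite_K
    by (intro sum.group[symmetric]) (auto intro!: finite_PiE simp: PiE_iff split: if_splits)
  also have "\<dots> = (\<Sum>v\<in>K. \<Sum>g\<in>?B ?S (g0(b := v)). hom_weight {e \<in> E. \<not> e \<subseteq> S} g)"
    by (intro sum.cong refl) (use sub in auto)
  also have "\<dots> \<le> (\<Sum>v\<in>K. w {g0 a, v} * D ^ k)"
  proof (rule sum_mono)
    fix v assume v: "v \<in> K"
    have "(\<Sum>g\<in>?B ?S (g0(b := v)). hom_weight {e \<in> E. \<not> e \<subseteq> S} g)
        \<le> (\<Sum>g\<in>?B ?S (g0(b := v)). w {g0 a, v} * hom_weight {e \<in> E. \<not> e \<subseteq> ?S} g)"
      by (intro sum_mono split v)
    also have "\<dots> = w {g0 a, v} * (\<Sum>g\<in>?B ?S (g0(b := v)). hom_weight {e \<in> E. \<not> e \<subseteq> ?S} g)"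
      by (simp add: sum_distrib_left)
    also have "\<dots> \<le> w {g0 a, v} * D ^ card (V - ?S)"
      using Suc.prems g0 v ab card
      by (intro mult_left_mono Suc.hyps(1) w_nonneg) auto
    finally show "(\<Sum>g\<in>?B ?S (g0(b := v)). hom_weight {e \<in> E. \<not> e \<subseteq> S} g) \<le> w {g0 a, v} * D ^ k"
      by (simp add: card)
  qed
  also have "\<dots> = D ^ card (V - S)"
    using w_sum[OF g0[OF ab(2)]] by (simp add: sum_distrib_right[symmetric] card)
  finally show ?case .
qed

end

section \<open>Moments of the number of copies\<close>

text \<open>The law \<open>kronecker_graph\<close> with arbitrary ground set and
  probabilities.\<close>

definition bernoulli_subset :: "'e set \<Rightarrow> ('e \<Rightarrow> real) \<Rightarrow> 'e set pmf" where
  "bernoulli_subset A w =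
     map_pmf (\<lambda>\<omega>. {e \<in> A. \<omega> e}) (Pi_pmf A False (\<lambda>e. bernoulli_pmf (w e)))"

lemma finite_set_bernoulli_subset: "finite A \<Longrightarrow> finite (set_pmf (bernoulli_subset A w))"
  by (rule finite_subset[of _ "Pow A"]) (auto simp: bernoulli_subset_def)

text \<open>The event is a box in the product space: coordinates in \<open>F\<close> are forced to
  \<open>True\<close>, the others are free, so independence gives the product.\<close>

lemma prob_bernoulli_subset:
  assumes "finite A" "F \<subseteq> A" "\<And>e. e \<in> A \<Longrightarrow> 0 \<le> w e \<and> w e \<le> 1"
  shows "measure_pmf.prob (bernoulli_subset A w) {G. F \<subseteq> G} = (\<Prod>e\<in>F. w e)"
proof -
  let ?B = "\<lambda>e. if e \<in> F then {True} else UNIV"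
  have "measure_pmf.prob (bernoulli_subset A w) {G. F \<subseteq> G}
      = measure_pmf.prob (Pi_pmf A False (\<lambda>e. bernoulli_pmf (w e))) (Pi A ?B)"
    unfolding bernoulli_subset_def measure_map_pmf using assms(2)
    by (intro arg_cong2[of _ _ _ _ measure] refl) (auto simp: Pi_def)
  also have "\<dots> = (\<Prod>e\<in>A. measure_pmf.prob (bernoulli_pmf (w e)) (?B e))"
    using assms(1) by (rule measure_Pi_pmf_Pi)
  also have "\<dots> = (\<Prod>e\<in>A. if e \<in> F then w e else 1)"
    using assms(3) by (intro prod.cong refl) (auto simp: measure_pmf_single)
  also have "\<dots> = (\<Prod>e\<in>F. w e)"
    using assms(1,2) by (simp add: prod.If_cases Int_absorb1)
  finally show ?thesis .
qed

text \<open>Markov's inequality, with integrability from finite support. It serves twice: for the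
  number of copies, and for its squared deviation as Chebyshev's inequality.\<close>

lemma pmf_markov_finite:
  fixes u :: "'g \<Rightarrow> real"
  assumes "finite (set_pmf M)" "\<And>x. 0 \<le> u x" "0 < c" "\<And>x. Q x \<Longrightarrow> c \<le> u x"
  shows "measure_pmf.prob M {x. Q x} \<le> measure_pmf.expectation M u / c"
proof -
  have "measure_pmf.prob M {x. Q x} = measure_pmf.expectation M (indicator {x. Q x})"
    by simp
  also have "\<dots> \<le> measure_pmf.expectation M (\<lambda>x. u x / c)"
    using assms by (intro integral_mono integrable_measure_pmf_finite) (auto simp: indicator_def)
  finally show ?thesis by simp
qed

section \<open>Exact first and second moments\<close>

lemma inj_on_image_edges:
  assumes "E \<subseteq> [V]\<^bsup>2\<^esup>" "inj_on f V"
  shows "inj_on ((`) f) E"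
  by (rule inj_on_image, rule inj_on_subset[OF assms(2)]) (use assms(1) in \<open>auto simp: nsets_def\<close>)

context regular_weight
begin

definition embeddings :: "'a set \<Rightarrow> ('a \<Rightarrow> 'b) set" where
  "embeddings V = {f \<in> V \<rightarrow>\<^sub>E K. inj_on f V}"

text \<open>\<open>labeled_copies\<close> with a general vertex set \<open>K\<close>.\<close>

definition copies :: "'a set \<Rightarrow> 'a set set \<Rightarrow> 'b set set \<Rightarrow> ('a \<Rightarrow> 'b) set" where
  "copies V E G = {f \<in> V \<rightarrow>\<^sub>E K. inj_on f V \<and> (\<forall>e\<in>E. f ` e \<in> G)}"

abbreviation edge_law :: "'b set set pmf" where
  "edge_law \<equiv> bernoulli_subset ([K]\<^bsup>2\<^esup>) w"

lemma finite_set_edge_law: "finite (set_pmf edge_law)"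
  by (intro finite_set_bernoulli_subset finite_imp_finite_nsets finite_K)

lemma finite_maps: "finite V \<Longrightarrow> finite (V \<rightarrow>\<^sub>E K)"
  using finite_K by (intro finite_PiE) auto

lemma hom_weight_map_nonneg: "E \<subseteq> [V]\<^bsup>2\<^esup> \<Longrightarrow> f \<in> V \<rightarrow>\<^sub>E K \<Longrightarrow> 0 \<le> hom_weight E f"
  using hom_weight_bounds(1)[of f V E] by (auto simp: PiE_def)

lemma finite_embeddings: "finite V \<Longrightarrow> finite (embeddings V)"
  unfolding embeddings_def by (simp add: finite_maps)

lemma w_edge_bounds: "e \<in> [K]\<^bsup>2\<^esup> \<Longrightarrow> 0 \<le> w e \<and> w e \<le> 1"
  using w_image_bounds[of id K e] by simp

lemma embeddings_image_edges:
  assumes "f \<in> embeddings V" "E \<subseteq> [V]\<^bsup>2\<^esup>"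
  shows "(`) f ` E \<subseteq> [K]\<^bsup>2\<^esup>"
proof -
  have f: "inj_on f V" "f ` V \<subseteq> K" using assms(1) by (auto simp: embeddings_def)
  have "f ` e \<in> [K]\<^bsup>2\<^esup>" if "e \<in> E" for e
  proof -
    have e: "e \<subseteq> V" "finite e" "card e = 2" using that assms(2) by (auto simp: nsets_def)
    then have "card (f ` e) = 2" using f(1) by (metis card_image inj_on_subset)
    then show ?thesis using e f(2) by (auto simp: nsets_def)
  qed
  then show ?thesis by blast
qed

lemma prod_image_edges:
  assumes "f \<in> embeddings V" "E \<subseteq> [V]\<^bsup>2\<^esup>"
  shows "(\<Prod>e\<in>(`) f ` E. w e) = hom_weight E f"
  using assms inj_on_image_edges[of E V f]
  by (simp add: hom_weight_def embeddings_def prod.reindex)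

lemma card_copies:
  assumes "finite V"
  shows "real (card (copies V E G)) = (\<Sum>f\<in>embeddings V. indicator {G. (`) f ` E \<subseteq> G} G)"
proof -
  have "copies V E G = {f \<in> embeddings V. (`) f ` E \<subseteq> G}"
    by (auto simp: copies_def embeddings_def)
  moreover have "(\<Sum>f\<in>embeddings V. indicator {G. (`) f ` E \<subseteq> G} G :: real)
      = (\<Sum>f\<in>{f \<in> embeddings V. (`) f ` E \<subseteq> G}. 1)"
    unfolding indicator_def using finite_embeddings[OF assms]
    by (simp add: sum.If_cases Int_def)
  ultimately show ?thesis by simp
qed

text \<open>Linearity of expectation; injectivity makes the image edges distinct genuine pairs, so
  the probability of one copy is its \<open>hom_weight\<close>.\<close>

lemma expectation_card_copies:
  assumes "finite V" "E \<subseteq> [V]\<^bsup>2\<^esup>"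
  shows "measure_pmf.expectation edge_law (\<lambda>G. real (card (copies V E G)))
           = (\<Sum>f\<in>embeddings V. hom_weight E f)"
proof -
  have "measure_pmf.expectation edge_law (\<lambda>G. real (card (copies V E G)))
      = (\<Sum>f\<in>embeddings V. measure_pmf.expectation edge_law (indicator {G. (`) f ` E \<subseteq> G}))"
    unfolding card_copies[OF assms(1)]
    by (intro Bochner_Integration.integral_sum integrable_measure_pmf_finite finite_set_edge_law)
  also have "\<dots> = (\<Sum>f\<in>embeddings V. hom_weight E f)"
  proof (rule sum.cong)
    fix f assume f: "f \<in> embeddings V"
    show "measure_pmf.expectation edge_law (indicator {G. (`) f ` E \<subseteq> G}) = hom_weight E f"
      using prob_bernoulli_subset[OF finite_imp_finite_nsets[OF finite_K]
          embeddings_image_edges[OF f assms(2)] w_edge_bounds] prod_image_edges[OF f assms(2)]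
      by simp
  qed simp
  finally show ?thesis .
qed

lemma expectation_card_copies_square:
  assumes "finite V" "E \<subseteq> [V]\<^bsup>2\<^esup>"
  shows "measure_pmf.expectation edge_law (\<lambda>G. (real (card (copies V E G)))\<^sup>2)
           = (\<Sum>f\<in>embeddings V. \<Sum>g\<in>embeddings V. \<Prod>e\<in>(`) f ` E \<union> (`) g ` E. w e)"
proof -
  \<comment> \<open>Both copies are present exactly if the union of their edge sets is; shared edges
    thus enter the product only once.\<close>
  have ind: "indicator {G. A \<subseteq> G} G * indicator {G. B \<subseteq> G} G = (indicator {G. A \<union> B \<subseteq> G} G :: real)"
    for A B G :: "'b set set"
    by (auto simp: indicator_def)
  have "measure_pmf.expectation edge_law (\<lambda>G. (real (card (copies V E G)))\<^sup>2)
      = (\<Sum>f\<in>embeddings V. \<Sum>g\<in>embeddings V.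
           measure_pmf.expectation edge_law (indicator {G. (`) f ` E \<union> (`) g ` E \<subseteq> G}))"
    unfolding card_copies[OF assms(1)] power2_eq_square sum_product ind
    by (subst Bochner_Integration.integral_sum,
        (intro integrable_measure_pmf_finite finite_set_edge_law sum.cong refl
          Bochner_Integration.integral_sum)+)
  also have "\<dots> = (\<Sum>f\<in>embeddings V. \<Sum>g\<in>embeddings V. \<Prod>e\<in>(`) f ` E \<union> (`) g ` E. w e)"
  proof (intro sum.cong refl)
    fix f g :: "'a \<Rightarrow> 'b" assume fg: "f \<in> embeddings V" "g \<in> embeddings V"
    have "(`) f ` E \<union> (`) g ` E \<subseteq> [K]\<^bsup>2\<^esup>"
      using embeddings_image_edges[OF _ assms(2)] fg by blast
    from prob_bernoulli_subset[OF finite_imp_finite_nsets[OF finite_K] this w_edge_bounds]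
    show "measure_pmf.expectation edge_law (indicator {G. (`) f ` E \<union> (`) g ` E \<subseteq> G})
        = (\<Prod>e\<in>(`) f ` E \<union> (`) g ` E. w e)"
      by simp
  qed
  finally show ?thesis .
qed

text \<open>If \<open>S\<close> is the set of vertices that \<open>g\<close> maps into \<open>f ` V\<close>, then every edge not contained
  in \<open>S\<close> gives a factor that is not yet present in the weight of \<open>f\<close>.\<close>

lemma prod_union_edges_le:
  assumes "E \<subseteq> [V]\<^bsup>2\<^esup>" "finite V" "f \<in> embeddings V" "g \<in> embeddings V"
    and S: "S = {x \<in> V. g x \<in> f ` V}"
  shows "(\<Prod>e\<in>(`) f ` E \<union> (`) g ` E. w e) \<le> hom_weight E f * hom_weight {e \<in> E. \<not> e \<subseteq> S} g"
proof -
  let ?N = "{e \<in> E. \<not> e \<subseteq> S}"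
  have finE: "finite E" using assms(1,2) finite_subset finite_imp_finite_nsets by metis
  have EV: "e \<subseteq> V" if "e \<in> E" for e using that assms(1) by (auto simp: nsets_def)
  have N: "?N \<subseteq> [V]\<^bsup>2\<^esup>" using assms(1) by auto
  \<comment> \<open>An edge of \<open>?N\<close> has an end that \<open>g\<close> maps outside the
    image of \<open>f\<close>.\<close>
  have disj: "(`) f ` E \<inter> (`) g ` ?N = {}"
    using EV unfolding S by blast
  have bounds: "0 \<le> w e \<and> w e \<le> 1" if "e \<in> (`) f ` E \<union> (`) g ` E" for e
    using that embeddings_image_edges[OF assms(3,1)] embeddings_image_edges[OF assms(4,1)] w_edge_bounds
    by blast
  let ?U = "(`) f ` E \<union> (`) g ` E" and ?U' = "(`) f ` E \<union> (`) g ` ?N"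
  \<comment> \<open>Edges of the second copy that come from within \<open>S\<close> but are not
    shared are bounded by 1.\<close>
  have "(\<Prod>e\<in>?U. w e) = (\<Prod>e\<in>?U - ?U'. w e) * (\<Prod>e\<in>?U'. w e)"
    using finE by (intro prod.subset_diff) auto
  also have "\<dots> \<le> 1 * (\<Prod>e\<in>?U'. w e)"
    using bounds by (intro mult_right_mono prod_le_1 prod_nonneg) blast+
  also have "\<dots> = hom_weight E f * hom_weight ?N g"
    using finE disj prod_image_edges[OF assms(3,1)] prod_image_edges[OF assms(4) N]
    by (simp add: prod.union_disjoint)
  finally show ?thesis .
qed

text \<open>The maps \<open>g\<close> are classified by the set \<open>S\<close> they send into the
  image of \<open>f\<close> and by their restriction to \<open>S\<close>. There are at most
  \<open>2 ^ card V * card V ^ card V\<close> classes, and \<open>sum_extension_weight_le\<close>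
  bounds each of them.\<close>

lemma sum_meeting_le:
  assumes "graph_connected V E" "E \<subseteq> [V]\<^bsup>2\<^esup>" "finite V" "f \<in> embeddings V"
  shows "(\<Sum>g | g \<in> embeddings V \<and> g ` V \<inter> f ` V \<noteq> {}. \<Prod>e\<in>(`) f ` E \<union> (`) g ` E. w e)
           \<le> hom_weight E f * (2 ^ card V * real (card V) ^ card V * max 1 D ^ (card V - 1))"
proof -
  define I where "I = (SIGMA S:{S. S \<subseteq> V \<and> S \<noteq> {}}. S \<rightarrow>\<^sub>E f ` V)"
  let ?B = "\<lambda>(S, g0). PiE V (\<lambda>x. if x \<in> S then {g0 x} else K)"
  let ?h = "\<lambda>(S, g0) g. hom_weight E f * hom_weight {e \<in> E. \<not> e \<subseteq> S} g"
  have fVK: "f ` V \<subseteq> K" "f \<in> V \<rightarrow> K" using assms(4) by (auto simp: embeddings_def)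
  have cV: "card V \<ge> 1"
    using assms(1,3) by (simp add: graph_connected_def Suc_le_eq card_gt_0_iff)
  have hf: "0 \<le> hom_weight E f" by (rule hom_weight_bounds(1)[OF fVK(2) assms(2)])
  have finI: "finite I"
    unfolding I_def using assms(3)
    by (intro finite_SigmaI) (auto intro!: finite_PiE finite_subset[OF _ assms(3)])
  have BK: "g \<in> V \<rightarrow> K" if "i \<in> I" "g \<in> ?B i" for i g
  proof -
    obtain S g0 where i: "i = (S, g0)" by (cases i)
    show ?thesis
      using that fVK(1) unfolding i I_def by (fastforce simp: PiE_iff split: if_splits)
  qed
  \<comment> \<open>The sets \<open>?B i\<close> overlap, since they do not forbid vertices outside
    \<open>S\<close> from entering the image of \<open>f\<close>; a cover suffices.\<close>
  have "(\<Sum>g | g \<in> embeddings V \<and> g ` V \<inter> f ` V \<noteq> {}. \<Prod>e\<in>(`) f ` E \<union> (`) g ` E. w e)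
      \<le> (\<Sum>i\<in>I. sum (?h i) (?B i))"
  proof (rule sum_le_sum_cover)
    show "finite {g \<in> embeddings V. g ` V \<inter> f ` V \<noteq> {}}"
      using finite_embeddings[OF assms(3)] by simp
    show "finite (?B i)" for i
      using assms(3) finite_K by (cases i) (auto intro!: finite_PiE)
    show "0 \<le> ?h i g" if "i \<in> I" "g \<in> ?B i" for i g
    proof -
      have "{e \<in> E. \<not> e \<subseteq> fst i} \<subseteq> [V]\<^bsup>2\<^esup>" using assms(2) by blast
      then show ?thesis
        using hf hom_weight_bounds(1)[OF BK[OF that]] by (cases i) auto
    qed
    show "\<exists>i\<in>I. g \<in> ?B i \<and> (\<Prod>e\<in>(`) f ` E \<union> (`) g ` E. w e) \<le> ?h i g"
      if g: "g \<in> {g \<in> embeddings V. g ` V \<inter> f ` V \<noteq> {}}" for g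
    proof -
      define S where "S = {x \<in> V. g x \<in> f ` V}"
      have "(S, restrict g S) \<in> I" using g by (auto simp: I_def S_def)
      moreover have "g \<in> ?B (S, restrict g S)"
        using g by (auto simp: embeddings_def PiE_iff S_def)
      moreover have "(\<Prod>e\<in>(`) f ` E \<union> (`) g ` E. w e) \<le> ?h (S, restrict g S) g"
        using prod_union_edges_le[OF assms(2,3,4) _ S_def] g by simp
      ultimately show ?thesis by blast
    qed
  qed (rule finI)
  also have "\<dots> \<le> (\<Sum>i\<in>I. hom_weight E f * max 1 D ^ (card V - 1))"
  proof (rule sum_mono)
    fix i assume "i \<in> I"
    then obtain S g0 where i: "i = (S, g0)" "S \<subseteq> V" "S \<noteq> {}" "g0 \<in> S \<rightarrow>\<^sub>E f ` V"
      by (auto simp: I_def)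
    then have "g0 \<in> S \<rightarrow> K" using fVK by blast
    then have "(\<Sum>g\<in>?B i. hom_weight {e \<in> E. \<not> e \<subseteq> S} g) \<le> D ^ card (V - S)"
      using sum_extension_weight_le[OF assms(1-3) i(2,3)] i(1) by simp
    \<comment> \<open>\<open>max 1 D\<close> makes the bound monotone in the exponent even if
      \<open>D < 1\<close>. As \<open>S\<close> is nonempty, at most \<open>card V - 1\<close>
      vertices are new.\<close>
    also have "\<dots> \<le> max 1 D ^ card (V - S)"
      using D_pos by (intro power_mono) auto
    also have "\<dots> \<le> max 1 D ^ (card V - 1)"
    proof (intro power_increasing)
      have "card (V - S) < card V" using i assms(3) by (intro psubset_card_mono) auto
      then show "card (V - S) \<le> card V - 1" by simp
    qed simp
    finally show "sum (?h i) (?B i) \<le> hom_weight E f * max 1 D ^ (card V - 1)"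
      using hf i(1) by (auto simp: sum_distrib_left[symmetric] intro: mult_left_mono)
  qed
  also have "\<dots> = card I * (hom_weight E f * max 1 D ^ (card V - 1))" by simp
  also have "\<dots> \<le> (2 ^ card V * card V ^ card V) * (hom_weight E f * max 1 D ^ (card V - 1))"
  proof (intro mult_right_mono)
    have "card I = (\<Sum>S\<in>{S. S \<subseteq> V \<and> S \<noteq> {}}. card (S \<rightarrow>\<^sub>E f ` V))"
      unfolding I_def using assms(3)
      by (intro card_SigmaI) (auto intro!: finite_PiE finite_subset[OF _ assms(3)])
    also have "\<dots> \<le> (\<Sum>S\<in>{S. S \<subseteq> V \<and> S \<noteq> {}}. card V ^ card V)"
    proof (rule sum_mono)
      fix S assume "S \<in> {S. S \<subseteq> V \<and> S \<noteq> {}}"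
      then have S: "S \<subseteq> V" "finite S" using assms(3) finite_subset by auto
      have "card (S \<rightarrow>\<^sub>E f ` V) = card (f ` V) ^ card S" using S(2) by (simp add: card_PiE)
      also have "\<dots> \<le> card V ^ card S" by (intro power_mono card_image_le assms(3)) simp
      also have "\<dots> \<le> card V ^ card V"
        by (intro power_increasing card_mono S(1) assms(3) cV)
      finally show "card (S \<rightarrow>\<^sub>E f ` V) \<le> card V ^ card V" .
    qed
    also have "\<dots> = card {S. S \<subseteq> V \<and> S \<noteq> {}} * card V ^ card V" by simp
    also have "\<dots> \<le> card (Pow V) * card V ^ card V"
      using assms(3) by (intro mult_right_mono card_mono) auto
    finally have "card I \<le> 2 ^ card V * card V ^ card V" using assms(3) by (simp add: card_Pow)
    then have "real (card I) \<le> real (2 ^ card V * card V ^ card V)" by (rule of_nat_mono)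
    then show "real (card I) \<le> 2 ^ card V * card V ^ card V" by simp
  qed (use hf in auto)
  finally show ?thesis by (simp add: mult_ac)
qed

section \<open>Moment bounds for trees\<close>

lemma expectation_card_copies_tree_le:
  assumes "grown_tree V E"
  shows "measure_pmf.expectation edge_law (\<lambda>G. real (card (copies V E G))) \<le> card K * D ^ card E"
proof -
  have E: "finite V" "E \<subseteq> [V]\<^bsup>2\<^esup>"
    using grown_tree_finite[OF assms] grown_tree_edges_nsets[OF assms] by auto
  have "(\<Sum>f\<in>embeddings V. hom_weight E f) \<le> (\<Sum>f\<in>V \<rightarrow>\<^sub>E K. hom_weight E f)"
    using finite_maps[OF E(1)] hom_weight_map_nonneg[OF E(2)]
    by (intro sum_mono2) (auto simp: embeddings_def)
  then show ?thesis
    by (simp add: expectation_card_copies[OF E] sum_hom_weight_tree[OF assms])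
qed

text \<open>The total weight of all maps minus that of the non-injective ones.\<close>

lemma expectation_card_copies_tree_ge:
  assumes "grown_tree V E"
  shows "card K * D ^ card E - (card V)\<^sup>2 * (card K * D ^ card E) * (m / D)
           \<le> measure_pmf.expectation edge_law (\<lambda>G. real (card (copies V E G)))"
proof -
  have E: "finite V" "E \<subseteq> [V]\<^bsup>2\<^esup>"
    using grown_tree_finite[OF assms] grown_tree_edges_nsets[OF assms] by auto
  have fin: "finite (V \<rightarrow>\<^sub>E K)" by (rule finite_maps[OF E(1)])
  have "(\<Sum>f\<in>V \<rightarrow>\<^sub>E K. hom_weight E f)
      = (\<Sum>f\<in>V \<rightarrow>\<^sub>E K. (if inj_on f V then hom_weight E f else 0)
          + (if inj_on f V then 0 else hom_weight E f))"
    by (intro sum.cong) auto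
  also have "\<dots> = (\<Sum>f\<in>embeddings V. hom_weight E f)
      + (\<Sum>f\<in>V \<rightarrow>\<^sub>E K. if inj_on f V then 0 else hom_weight E f)"
    using fin by (simp add: sum.distrib embeddings_def sum.inter_filter)
  finally show ?thesis
    using sum_noninj_hom_weight_tree[OF assms]
    by (simp add: expectation_card_copies[OF E] sum_hom_weight_tree[OF assms])
qed

text \<open>For fixed \<open>f\<close>, maps \<open>g\<close> with disjoint image contribute at most
  the total weight of all maps, and those that meet it are handled by \<open>sum_meeting_le\<close>.
  Summing over \<open>f\<close> then yields the expectation as a factor.\<close>

lemma expectation_card_copies_square_tree_le:
  assumes "grown_tree V E" "graph_connected V E"
  shows "measure_pmf.expectation edge_law (\<lambda>G. (real (card (copies V E G)))\<^sup>2)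
           \<le> measure_pmf.expectation edge_law (\<lambda>G. real (card (copies V E G)))
              * (card K * D ^ card E + 2 ^ card V * real (card V) ^ card V * max 1 D ^ card E)"
proof -
  have E: "finite V" "E \<subseteq> [V]\<^bsup>2\<^esup>" "finite E"
    using grown_tree_finite[OF assms(1)] grown_tree_edges_nsets[OF assms(1)] by auto
  have cE: "card V - 1 = card E" using grown_tree_card[OF assms(1)] by simp
  let ?C = "2 ^ card V * real (card V) ^ card V * max 1 D ^ card E"
  have step: "(\<Sum>g\<in>embeddings V. \<Prod>e\<in>(`) f ` E \<union> (`) g ` E. w e)
      \<le> hom_weight E f * (card K * D ^ card E + ?C)" if f: "f \<in> embeddings V" for f
  proof -
    let ?W = "\<lambda>g. \<Prod>e\<in>(`) f ` E \<union> (`) g ` E. w e"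
    let ?M = "{g \<in> embeddings V. g ` V \<inter> f ` V \<noteq> {}}"
    have hf: "0 \<le> hom_weight E f"
      using f by (intro hom_weight_map_nonneg[OF E(2)]) (auto simp: embeddings_def)
    have fin: "finite (embeddings V :: ('a \<Rightarrow> 'b) set)" by (rule finite_embeddings[OF E(1)])
    have split: "sum ?W (embeddings V) = sum ?W (embeddings V - ?M) + sum ?W ?M"
      using fin by (intro sum.subset_diff) auto
    \<comment> \<open>Copies with disjoint vertex sets share no edge, so they are
      independent.\<close>
    have "sum ?W (embeddings V - ?M) = (\<Sum>g\<in>embeddings V - ?M. hom_weight E f * hom_weight E g)"
    proof (rule sum.cong)
      fix g assume g: "g \<in> embeddings V - ?M"
      have "f ` e \<noteq> g ` e'" if "e \<in> E" "e' \<in> E" for e e'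
      proof -
        have "e \<noteq> {}" "e \<subseteq> V" "e' \<subseteq> V" using that E(2) by (auto simp: nsets_def)
        then have "f ` e \<subseteq> f ` V" "g ` e' \<subseteq> g ` V" "f ` e \<noteq> {}" by auto
        moreover have "g ` V \<inter> f ` V = {}" using g by blast
        ultimately show ?thesis by (metis le_inf_iff subset_empty)
      qed
      then have "(`) f ` E \<inter> (`) g ` E = {}" by auto
      then show "?W g = hom_weight E f * hom_weight E g"
        using g E(3) prod_image_edges[OF f E(2)] prod_image_edges[OF _ E(2), of g]
        by (simp add: prod.union_disjoint)
    qed simp
    also have "\<dots> \<le> (\<Sum>g\<in>V \<rightarrow>\<^sub>E K. hom_weight E f * hom_weight E g)"
      using finite_maps[OF E(1)] hf hom_weight_map_nonneg[OF E(2)]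
      by (intro sum_mono2) (auto intro!: mult_nonneg_nonneg simp: embeddings_def)
    also have "\<dots> = hom_weight E f * (card K * D ^ card E)"
      by (simp add: sum_distrib_left[symmetric] sum_hom_weight_tree[OF assms(1)])
    finally show ?thesis
      using split sum_meeting_le[OF assms(2) E(2,1) f] cE by (simp add: distrib_left)
  qed
  show ?thesis
    unfolding expectation_card_copies_square[OF E(1,2)] expectation_card_copies[OF E(1,2)]
      sum_distrib_right
    by (intro sum_mono step)
qed

text \<open>The deviation is taken from \<mu> and not from the mean \<open>x\<close>, so one
  estimate covers both the variance and the gap between \<open>x\<close> and \<mu>.\<close>

lemma mean_square_deviation_tree_le:
  fixes V :: "'a set"
  assumes "grown_tree V E" "graph_connected V E"
  defines "\<mu> \<equiv> card K * D ^ card E"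
  shows "measure_pmf.expectation edge_law (\<lambda>G. (real (card (copies V E G)) - \<mu>)\<^sup>2)
           \<le> \<mu>\<^sup>2 * ((card V)\<^sup>2 * (m / D)) + \<mu> * (2 ^ card V * real (card V) ^ card V * max 1 D ^ card E)"
proof -
  let ?X = "\<lambda>G. real (card (copies V E G))"
  let ?C = "2 ^ card V * real (card V) ^ card V * max 1 D ^ card E"
  define x where "x = measure_pmf.expectation edge_law ?X"
  have \<mu>: "0 \<le> \<mu>" using D_pos by (simp add: \<mu>_def)
  have x: "x \<le> \<mu>" "\<mu> - (card V)\<^sup>2 * \<mu> * (m / D) \<le> x"
    using expectation_card_copies_tree_le[OF assms(1)] expectation_card_copies_tree_ge[OF assms(1)]
    by (auto simp: x_def \<mu>_def)
  have "measure_pmf.expectation edge_law (\<lambda>G. (?X G - \<mu>)\<^sup>2)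
      = measure_pmf.expectation edge_law (\<lambda>G. (?X G)\<^sup>2 - 2 * \<mu> * ?X G + \<mu>\<^sup>2)"
    by (simp add: power2_eq_square algebra_simps)
  also have "\<dots> = measure_pmf.expectation edge_law (\<lambda>G. (?X G)\<^sup>2) - 2 * \<mu> * x + \<mu>\<^sup>2"
    unfolding x_def by (simp add: integrable_measure_pmf_finite[OF finite_set_edge_law])
  also have "\<dots> \<le> x * (\<mu> + ?C) - 2 * \<mu> * x + \<mu>\<^sup>2"
    using expectation_card_copies_square_tree_le[OF assms(1,2)] by (simp add: x_def \<mu>_def)
  also have "\<dots> = \<mu> * (\<mu> - x) + x * ?C" by (simp add: power2_eq_square algebra_simps)
  also have "\<dots> \<le> \<mu> * ((card V)\<^sup>2 * \<mu> * (m / D)) + \<mu> * ?C"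
    using x \<mu> by (intro add_mono mult_left_mono mult_right_mono) auto
  finally show ?thesis by (simp add: power2_eq_square algebra_simps)
qed

end

section \<open>Kronecker graphs\<close>

lemma UNIV_bit: "(UNIV :: bit set) = {0, 1}"
  using bit_not_zero_iff by blast

lemma finite_UNIV_bit: "finite (UNIV :: bit set)"
  by (simp add: UNIV_bit)

lemma finite_kron_vertices: "finite (kron_vertices n)"
  unfolding kron_vertices_def by (intro finite_PiE) (simp_all add: finite_UNIV_bit)

lemma card_kron_vertices: "card (kron_vertices n) = 2 ^ n"
  by (simp add: kron_vertices_def card_PiE UNIV_bit numeral_2_eq_2)

text \<open>The sum over digit strings factors into one row sum of \<open>P\<close> per
  digit.\<close>

lemma kron_prob_sum:
  assumes "\<And>i. (\<Sum>j\<in>UNIV. P i j) = d"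
  shows "(\<Sum>v\<in>kron_vertices n. kron_prob n P u v) = d ^ n"
proof -
  have "(\<Sum>v\<in>kron_vertices n. kron_prob n P u v) = (\<Prod>k=1..n. \<Sum>j\<in>UNIV. P (u k) j)"
    unfolding kron_prob_def kron_vertices_def by (subst prod_sum_PiE) (simp_all add: finite_UNIV_bit)
  then show ?thesis using assms by simp
qed

text \<open>Equal diagonal entries make both rows of the matrix sum to \<alpha> + \<beta>, which is
  what makes the weights regular.\<close>

lemma regular_weight_kron:
  assumes "0 < \<alpha>" "\<alpha> < 1" "0 < \<beta>" "\<beta> < 1"
  shows "regular_weight (kron_vertices n) (kron_edge_prob n (kron_matrix \<alpha> \<beta> \<alpha>))
           ((\<alpha> + \<beta>) ^ n) (max \<alpha> \<beta> ^ n)"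
proof -
  let ?P = "kron_matrix \<alpha> \<beta> \<alpha>"
  have w: "kron_edge_prob n ?P {u, v} = kron_prob n ?P u v" for u v
    by (intro kron_edge_prob_doubleton kron_matrix_sym)
  have row: "(\<Sum>j\<in>UNIV. ?P i j) = \<alpha> + \<beta>" for i
    by (cases i) (auto simp: kron_matrix_def UNIV_bit)
  have P: "0 \<le> ?P i j" "?P i j \<le> max \<alpha> \<beta>" for i j
    using assms by (auto simp: kron_matrix_def)
  have nonneg: "0 \<le> kron_prob n ?P u v" for u v
    unfolding kron_prob_def by (intro prod_nonneg P ballI)
  have le: "kron_prob n ?P u v \<le> max \<alpha> \<beta> ^ n" for u v
  proof -
    have "kron_prob n ?P u v \<le> (\<Prod>k=1..n. max \<alpha> \<beta>)"
      unfolding kron_prob_def by (intro prod_mono conjI P)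
    then show ?thesis by simp
  qed
  have "max \<alpha> \<beta> ^ n \<le> 1" using assms by (intro power_le_one) auto
  then have le1: "kron_prob n ?P u v \<le> 1" for u v using le[of u v] by linarith
  show ?thesis
    by unfold_locales
      (use assms nonneg le le1 kron_prob_sum[OF row] in \<open>auto simp: w finite_kron_vertices\<close>)
qed

lemma kronecker_graph_bernoulli_subset:
  "kronecker_graph n P = bernoulli_subset ([kron_vertices n]\<^bsup>2\<^esup>) (kron_edge_prob n P)"
  by (simp add: kronecker_graph_def bernoulli_subset_def)

lemma finite_set_kronecker_graph: "finite (set_pmf (kronecker_graph n P))"
  unfolding kronecker_graph_bernoulli_subset
  by (intro finite_set_bernoulli_subset finite_imp_finite_nsets finite_kron_vertices)

section \<open>From moment bounds to a.a.s. statements\<close>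

lemma aasI_bad_prob:
  assumes "\<And>n. measure_pmf.prob (M n) {G. \<not> Q n G} \<le> b n" "b \<longlonglongrightarrow> 0"
  shows "aas M Q"
proof -
  have compl: "measure_pmf.prob (M n) {G. Q n G} = 1 - measure_pmf.prob (M n) {G. \<not> Q n G}" for n
    using measure_pmf.prob_compl[of "{G. \<not> Q n G}" "M n"]
    by (simp add: Compl_eq_Diff_UNIV[symmetric] Collect_neg_eq[symmetric])
  have "(\<lambda>n. measure_pmf.prob (M n) {G. \<not> Q n G}) \<longlonglongrightarrow> 0"
    by (rule tendsto_sandwich[OF _ _ tendsto_const assms(2)]) (auto simp: assms(1))
  from tendsto_diff[OF tendsto_const[of 1] this] show ?thesis
    unfolding aas_def compl by simp
qed

text \<open>Chebyshev's inequality around \<open>f n\<close>, with \<epsilon> the relative mean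
  square error.\<close>

lemma aas_asympI_mean_square:
  fixes X :: "nat \<Rightarrow> 'g \<Rightarrow> real"
  assumes "\<And>n. finite (set_pmf (M n))"
    and f: "\<And>n. 0 < f n" and \<epsilon>: "\<And>n. 0 < \<epsilon> n" "\<epsilon> \<longlonglongrightarrow> 0"
    and "\<And>n. measure_pmf.expectation (M n) (\<lambda>G. (X n G - f n)\<^sup>2) \<le> (f n)\<^sup>2 * \<epsilon> n"
  shows "aas_asymp M X f"
proof -
  \<comment> \<open>With the fourth root, the tolerance \<delta> and the failure bound \<epsilon> /
    \<delta>^2 = sqrt \<epsilon> both tend to 0.\<close>
  define \<delta> where "\<delta> n = sqrt (sqrt (\<epsilon> n))" for n
  have \<delta>: "0 < \<delta> n" "(\<delta> n)\<^sup>2 = sqrt (\<epsilon> n)" for n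
    using \<epsilon>(1)[of n] by (auto simp: \<delta>_def)
  have "\<delta> \<longlonglongrightarrow> 0"
    unfolding \<delta>_def using tendsto_real_sqrt[OF tendsto_real_sqrt[OF \<epsilon>(2)]] by simp
  moreover have "aas M (\<lambda>n G. \<exists>e. \<bar>e\<bar> \<le> \<delta> n \<and> X n G = (1 + e) * f n)"
  proof (rule aasI_bad_prob)
    fix n
    have "measure_pmf.prob (M n) {G. \<not> (\<exists>e. \<bar>e\<bar> \<le> \<delta> n \<and> X n G = (1 + e) * f n)}
        \<le> measure_pmf.expectation (M n) (\<lambda>G. (X n G - f n)\<^sup>2) / (\<delta> n * f n)\<^sup>2"
    proof (rule pmf_markov_finite[OF assms(1)])
      fix G assume bad: "\<not> (\<exists>e. \<bar>e\<bar> \<le> \<delta> n \<and> X n G = (1 + e) * f n)"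
      have "X n G = (1 + (X n G - f n) / f n) * f n"
        using f[of n] by (simp add: field_simps)
      then have "\<delta> n < \<bar>(X n G - f n) / f n\<bar>" using bad not_le by blast
      then have "\<delta> n * f n \<le> \<bar>X n G - f n\<bar>"
        using f[of n] by (simp add: abs_divide pos_less_divide_eq)
      then show "(\<delta> n * f n)\<^sup>2 \<le> (X n G - f n)\<^sup>2"
        using f[of n] \<delta>(1)[of n] by (intro abs_le_square_iff[THEN iffD1]) simp
    qed (use f[of n] \<delta>(1)[of n] in auto)
    also have "\<dots> \<le> ((f n)\<^sup>2 * \<epsilon> n) / (\<delta> n * f n)\<^sup>2"
      by (intro divide_right_mono assms(5)) simp
    also have "\<dots> = \<epsilon> n / sqrt (\<epsilon> n)"
      using f[of n] \<delta>[of n] by (simp add: power_mult_distrib)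
    also have "\<dots> = sqrt (\<epsilon> n)"
      using \<epsilon>(1)[of n] by (simp add: real_div_sqrt)
    finally show "measure_pmf.prob (M n) {G. \<not> (\<exists>e. \<bar>e\<bar> \<le> \<delta> n \<and> X n G = (1 + e) * f n)} \<le> sqrt (\<epsilon> n)" .
  next
    show "(\<lambda>n. sqrt (\<epsilon> n)) \<longlonglongrightarrow> 0" using tendsto_real_sqrt[OF \<epsilon>(2)] by simp
  qed
  ultimately show ?thesis unfolding aas_asymp_def by blast
qed

text \<open>Turns the overlap factor, with \<open>D = d ^ n\<close>, into an \<open>n\<close>-th
  power that can be compared with the \<open>n\<close>-th power of \<mu>.\<close>

lemma max_1_power: "0 \<le> d \<Longrightarrow> max 1 (d ^ n) ^ e = max 1 (d ^ e) ^ n" for d :: real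
proof (cases "d \<le> 1")
  case True
  assume "0 \<le> d"
  then have "d ^ n \<le> 1" "d ^ e \<le> 1" using True by (auto intro: power_le_one)
  then show ?thesis by (simp add: max_def)
next
  case False
  then have "1 \<le> d ^ n" "1 \<le> d ^ e" by (auto intro: one_le_power)
  then show ?thesis by (simp add: max.absorb2 power_mult[symmetric] mult.commute)
qed

theorem theorem16:
  fixes \<alpha> \<beta> \<gamma> :: real and V :: "'a set" and E :: "'a set set"
  assumes "0 < \<alpha>" "\<alpha> < 1" and "0 < \<beta>" "\<beta> < 1" and "0 < \<gamma>" "\<gamma> < 1"
    and "tree_graph V E"
    and "\<alpha> = \<gamma>"
  shows "(2 * (\<alpha> + \<beta>) ^ card E < 1 \<longrightarrow>
            aas (\<lambda>n. kronecker_graph n (kron_matrix \<alpha> \<beta> \<gamma>))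
              (\<lambda>n G. labeled_copies V E n G = {})) \<and>
         (2 * (\<alpha> + \<beta>) ^ card E > 1 \<longrightarrow>
            aas_asymp (\<lambda>n. kronecker_graph n (kron_matrix \<alpha> \<beta> \<gamma>))
              (\<lambda>n G. real (num_copies V E n G))
              (\<lambda>n. (2 * (\<alpha> + \<beta>) ^ card E) ^ n))"
proof -
  define d where "d = \<alpha> + \<beta>"
  define \<mu> where "\<mu> = 2 * d ^ card E"
  define M where "M n = kronecker_graph n (kron_matrix \<alpha> \<beta> \<gamma>)" for n
  let ?X = "\<lambda>n G. real (num_copies V E n G)"
  have tree: "grown_tree V E" by (rule tree_graph_grown_tree[OF assms(7)])
  have conn: "graph_connected V E" using assms(7) by (simp add: tree_graph_def)
  have d: "0 < d" and \<mu>: "0 < \<mu>" using assms by (auto simp: d_def \<mu>_def)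
  have finM: "finite (set_pmf (M n))" for n
    unfolding M_def by (rule finite_set_kronecker_graph)
  have rw: "regular_weight (kron_vertices n) (kron_edge_prob n (kron_matrix \<alpha> \<beta> \<gamma>)) (d ^ n) (max \<alpha> \<beta> ^ n)"
    for n using regular_weight_kron[OF assms(1-4)] assms(8) by (simp add: d_def)
  have X: "?X n G = real (card (regular_weight.copies (kron_vertices n) V E G))" for n G
    by (simp add: num_copies_def labeled_copies_def regular_weight.copies_def[OF rw])
  have \<mu>n: "real (card (kron_vertices n)) * (d ^ n) ^ card E = \<mu> ^ n" for n
    by (simp add: card_kron_vertices \<mu>_def power_mult_distrib power_mult[symmetric] mult.commute)
  have first_moment: "measure_pmf.expectation (M n) (?X n) \<le> \<mu> ^ n" for n
    using regular_weight.expectation_card_copies_tree_le[OF rw tree, of n]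
    by (simp only: M_def X \<mu>n kronecker_graph_bernoulli_subset)
  have "aas M (\<lambda>n G. labeled_copies V E n G = {})" if "\<mu> < 1"
  proof (rule aasI_bad_prob)
    fix n
    \<comment> \<open>The count is an integer, so it is at least 1 as soon as a copy exists; hence
      Markov's inequality with threshold 1.\<close>
    have "measure_pmf.prob (M n) {G. labeled_copies V E n G \<noteq> {}} \<le> measure_pmf.expectation (M n) (?X n) / 1"
    proof (rule pmf_markov_finite[OF finM])
      fix G assume "labeled_copies V E n G \<noteq> {}"
      moreover have "finite (labeled_copies V E n G)"
        unfolding labeled_copies_def
        by (intro finite_Collect_conjI disjI1, subst Collect_mem_eq)
          (use regular_weight.finite_maps[OF rw] grown_tree_finite[OF tree] in blast)
      ultimately have "0 < num_copies V E n G" by (simp add: num_copies_def card_gt_0_iff)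
      then show "1 \<le> ?X n G" by simp
    qed auto
    also have "\<dots> \<le> \<mu> ^ n" using first_moment by simp
    finally show "measure_pmf.prob (M n) {G. labeled_copies V E n G \<noteq> {}} \<le> \<mu> ^ n" .
  qed (use \<mu> that in \<open>auto intro: LIMSEQ_realpow_zero\<close>)
  moreover have "aas_asymp M ?X (\<lambda>n. \<mu> ^ n)" if "1 < \<mu>"
  proof -
    \<comment> \<open>\<open>r\<close> is the decay rate of the non-injective maps and
      \<open>s\<close> that of the overlapping pairs, both relative to the main term.\<close>
    define r where "r = max \<alpha> \<beta> / d"
    define s where "s = max 1 (d ^ card E) / \<mu>"
    define C where "C = 2 ^ card V * real (card V) ^ card V"
    define \<epsilon> where "\<epsilon> n = (real (card V))\<^sup>2 * r ^ n + C * s ^ n" for n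
    have cV: "0 < card V"
      using grown_tree_nonempty[OF tree] grown_tree_finite[OF tree] by (simp add: card_gt_0_iff)
    have r: "0 < r" "r < 1" using assms d by (auto simp: r_def d_def)
    \<comment> \<open>\<mu> exceeds both entries of the maximum: 1 by assumption, and
      \<open>d ^ card E\<close> because \<mu> is twice that number.\<close>
    have s: "0 < s" "s < 1" using that d by (auto simp: s_def \<mu>_def)
    show ?thesis
    proof (rule aas_asympI_mean_square[of M _ \<epsilon>])
      show "0 < \<epsilon> n" for n
        unfolding \<epsilon>_def C_def using r s cV by (intro add_pos_pos mult_pos_pos zero_less_power) auto
      have "\<epsilon> \<longlonglongrightarrow> (real (card V))\<^sup>2 * 0 + C * 0"
        unfolding \<epsilon>_def using r s by (intro tendsto_intros LIMSEQ_realpow_zero) auto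
      then show "\<epsilon> \<longlonglongrightarrow> 0" by simp
      show "measure_pmf.expectation (M n) (\<lambda>G. (?X n G - \<mu> ^ n)\<^sup>2) \<le> (\<mu> ^ n)\<^sup>2 * \<epsilon> n" for n
      proof -
        have "measure_pmf.expectation (M n) (\<lambda>G. (?X n G - \<mu> ^ n)\<^sup>2)
            \<le> (\<mu> ^ n)\<^sup>2 * ((card V)\<^sup>2 * (max \<alpha> \<beta> ^ n / d ^ n)) + \<mu> ^ n * (C * max 1 (d ^ n) ^ card E)"
          using regular_weight.mean_square_deviation_tree_le[OF rw tree conn, of n]
          by (simp only: M_def X \<mu>n kronecker_graph_bernoulli_subset C_def)
        also have "max 1 (d ^ n) ^ card E = \<mu> ^ n * s ^ n"
          using d \<mu> by (simp add: max_1_power s_def power_divide)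
        also have "max \<alpha> \<beta> ^ n / d ^ n = r ^ n" by (simp add: r_def power_divide)
        finally show ?thesis by (simp add: \<epsilon>_def power2_eq_square algebra_simps)
      qed
    qed (use finM \<mu> in auto)
  qed
  ultimately show ?thesis unfolding M_def \<mu>_def d_def by blast
qed

end
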